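(* The residuated lattices (respectively, bounded residuated lattices) that are based on $\mathbf{M}_X$ for some set $X$, together with the trivial (one-element) algebra, are precisely the members of the class $\mathsf{URL}_3$ (respectively, $\mathsf{bURL}_3$), i.e., the (bounded) residuated lattices that satisfy both $$\forall u_1,u_2,z,w\ \big(u_1\le u_2 \text{ or } u_2\le u_1 \text{ or } (u_1\wedge u_2\le w \text{ and } z\le u_1\vee u_2)\big)$$ and $$\forall x_1,x_2,x_3,x_4\ \big(x_1=x_1\vee x_2 \text{ or } x_1\vee x_2=x_1\vee x_2\vee x_3 \text{ or } x_1\vee x_2\vee x_3=x_1\vee x_2\vee x_3\vee x_4\big).$$
   Context: A residuated lattice is an algebra $(R,\wedge,\vee,\cdot,\backslash,/,1)$ such that $(R,\wedge,\vee)$ is a lattice, $(R,\cdot,1)$ is a monoid, and for all $x,y,z\in R$: $xy\le z \iff y\le x\backslash z \iff x\le z/y$. A bounded residuated lattice is an expansion of a residuated lattice with a bounded lattice reduct by constants $\bot,\top$ naming the least and greatest elements. For a set $X$, $\mathbf{M}_X$ is the lattice on $X\cup\{\bot,\top\}$ ($\bot\neq\top$, neither in $X$) with top $\top$, bottom $\bot$, and $x\vee y=\top$, $x\wedge y=\bot$ for distinct $x,y\in X$. "Based on $\mathbf{M}_X$" means that the lattice reduct is (isomorphic to) $\mathbf{M}_X$. *)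

theory Defs
  imports "HOL-Algebra.Lattice" "HOL-Algebra.Group"
begin

text \<open>
  Algebras in the full signature of residuated lattices; \<open>under R x z\<close> is \<open>x \ z\<close> and
  \<open>over R z y\<close> is \<open>z / y\<close>.
\<close>

record 'a res_lattice = "'a monoid" +
  wedge :: "['a, 'a] \<Rightarrow> 'a" (infixl \<open>\<curlywedge>\<index>\<close> 70)
  vee :: "['a, 'a] \<Rightarrow> 'a" (infixl \<open>\<curlyvee>\<index>\<close> 65)
  under :: "['a, 'a] \<Rightarrow> 'a"
  over :: "['a, 'a] \<Rightarrow> 'a"

record 'a bdd_res_lattice = "'a res_lattice" +
  bot_const :: 'a
  top_const :: 'a

definition lattice_reduct :: "('a, 'm) res_lattice_scheme \<Rightarrow> 'a gorder" where
  "lattice_reduct R = \<lparr>carrier = carrier R, eq = (=), le = (\<lambda>x y. x \<curlywedge>\<^bsub>R\<^esub> y = x)\<rparr>"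

abbreviation rle :: "('a, 'm) res_lattice_scheme \<Rightarrow> 'a \<Rightarrow> 'a \<Rightarrow> bool"
    (\<open>(_ \<preceq>\<index> _)\<close> [51, 51] 50) where
  "x \<preceq>\<^bsub>R\<^esub> y \<equiv> le (lattice_reduct R) x y"

text \<open>
  HOL-Algebra treats lattices as ordered sets, so the lattice axioms for \<open>wedge\<close> and \<open>vee\<close> say
  that the relation \<open>x \<curlywedge> y = x\<close> is a lattice order whose infima and suprema they are.
\<close>

locale residuated_lattice = monoid R for R (structure) +
  assumes lattice_reduct: "lattice (lattice_reduct R)"
    and wedge_is_meet:
      "\<lbrakk>x \<in> carrier R; y \<in> carrier R\<rbrakk> \<Longrightarrow> x \<curlywedge> y = x \<sqinter>\<^bsub>lattice_reduct R\<^esub> y"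
    and vee_is_join:
      "\<lbrakk>x \<in> carrier R; y \<in> carrier R\<rbrakk> \<Longrightarrow> x \<curlyvee> y = x \<squnion>\<^bsub>lattice_reduct R\<^esub> y"
    and under_closed: "\<lbrakk>x \<in> carrier R; z \<in> carrier R\<rbrakk> \<Longrightarrow> under R x z \<in> carrier R"
    and over_closed: "\<lbrakk>z \<in> carrier R; y \<in> carrier R\<rbrakk> \<Longrightarrow> over R z y \<in> carrier R"
    and under_residual:
      "\<lbrakk>x \<in> carrier R; y \<in> carrier R; z \<in> carrier R\<rbrakk> \<Longrightarrow> x \<otimes> y \<preceq> z \<longleftrightarrow> y \<preceq> under R x z"
    and over_residual:
      "\<lbrakk>x \<in> carrier R; y \<in> carrier R; z \<in> carrier R\<rbrakk> \<Longrightarrow> x \<otimes> y \<preceq> z \<longleftrightarrow> x \<preceq> over R z y"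

locale bounded_residuated_lattice = residuated_lattice R
  for R :: "('a, 'm) bdd_res_lattice_scheme" (structure) +
  assumes bot_least: "least (lattice_reduct R) (bot_const R) (carrier R)"
    and top_greatest: "greatest (lattice_reduct R) (top_const R) (carrier R)"

definition trivial_algebra :: "('a, 'm) partial_object_scheme \<Rightarrow> bool" where
  "trivial_algebra R \<longleftrightarrow> (\<exists>a. carrier R = {a})"

datatype 'x M_elem = M_bot | M_top | M_atom 'x

definition M_lattice :: "'x set \<Rightarrow> 'x M_elem gorder" where
  "M_lattice X = \<lparr>carrier = {M_bot, M_top} \<union> M_atom ` X, eq = (=),
     le = (\<lambda>a b. a = b \<or> a = M_bot \<or> b = M_top)\<rparr>"

lemma least_M_lattice_Upper:
  assumes "x \<in> X" "y \<in> X" "x \<noteq> y"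
  shows "least (M_lattice X) M_top (Upper (M_lattice X) {M_atom x, M_atom y})"
  using assms by (auto simp: least_def Upper_def M_lattice_def)

lemma greatest_M_lattice_Lower:
  assumes "x \<in> X" "y \<in> X" "x \<noteq> y"
  shows "greatest (M_lattice X) M_bot (Lower (M_lattice X) {M_atom x, M_atom y})"
  using assms by (auto simp: greatest_def Lower_def M_lattice_def)

lemma lattice_M_lattice: "lattice (M_lattice X)"
proof
  show "\<exists>s. least (M_lattice X) s (Upper (M_lattice X) {a, b})"
    if "a \<in> carrier (M_lattice X)" "b \<in> carrier (M_lattice X)" for a b
  proof -
    let ?s = "if a = b \<or> b = M_bot then a else if a = M_bot then b else M_top"
    have "least (M_lattice X) ?s (Upper (M_lattice X) {a, b})"
      using that by (auto simp: least_def Upper_def M_lattice_def split: if_splits)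
    then show ?thesis by blast
  qed
  show "\<exists>s. greatest (M_lattice X) s (Lower (M_lattice X) {a, b})"
    if "a \<in> carrier (M_lattice X)" "b \<in> carrier (M_lattice X)" for a b
  proof -
    let ?s = "if a = b \<or> b = M_top then a else if a = M_top then b else M_bot"
    have "greatest (M_lattice X) ?s (Lower (M_lattice X) {a, b})"
      using that by (auto simp: greatest_def Lower_def M_lattice_def split: if_splits)
    then show ?thesis by blast
  qed
qed (auto simp: M_lattice_def)

lemma M_lattice_join_meet:
  assumes "x \<in> X" "y \<in> X" "x \<noteq> y"
  shows "M_atom x \<squnion>\<^bsub>M_lattice X\<^esub> M_atom y = M_top"
    and "M_atom x \<sqinter>\<^bsub>M_lattice X\<^esub> M_atom y = M_bot"
proof -
  interpret lattice "M_lattice X" by (rule lattice_M_lattice)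
  show "M_atom x \<squnion>\<^bsub>M_lattice X\<^esub> M_atom y = M_top"
    unfolding join_def sup_def
    by (rule some_equality)
      (use least_M_lattice_Upper[OF assms] least_unique in \<open>blast\<close>)+
  show "M_atom x \<sqinter>\<^bsub>M_lattice X\<^esub> M_atom y = M_bot"
    unfolding meet_def inf_def
    by (rule some_equality)
      (use greatest_M_lattice_Lower[OF assms] greatest_unique in \<open>blast\<close>)+
qed

definition lattice_isomorphic :: "('a, 'c) gorder_scheme \<Rightarrow> ('b, 'd) gorder_scheme \<Rightarrow> bool" where
  "lattice_isomorphic L K \<longleftrightarrow>
     (\<exists>h. bij_betw h (carrier L) (carrier K) \<and> join_pres L K h \<and> meet_pres L K h)"

definition based_on_M :: "('a, 'm) res_lattice_scheme \<Rightarrow> 'x set \<Rightarrow> bool" where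
  "based_on_M R X \<longleftrightarrow> lattice_isomorphic (lattice_reduct R) (M_lattice X)"

definition unilinear :: "('a, 'm) res_lattice_scheme \<Rightarrow> bool" where
  "unilinear R \<longleftrightarrow>
     (\<forall>u\<^sub>1\<in>carrier R. \<forall>u\<^sub>2\<in>carrier R. \<forall>z\<in>carrier R. \<forall>w\<in>carrier R.
        u\<^sub>1 \<preceq>\<^bsub>R\<^esub> u\<^sub>2 \<or> u\<^sub>2 \<preceq>\<^bsub>R\<^esub> u\<^sub>1 \<or>
        (u\<^sub>1 \<curlywedge>\<^bsub>R\<^esub> u\<^sub>2 \<preceq>\<^bsub>R\<^esub> w \<and> z \<preceq>\<^bsub>R\<^esub> u\<^sub>1 \<curlyvee>\<^bsub>R\<^esub> u\<^sub>2))"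

definition height_le_3 :: "('a, 'm) res_lattice_scheme \<Rightarrow> bool" where
  "height_le_3 R \<longleftrightarrow>
     (\<forall>x\<^sub>1\<in>carrier R. \<forall>x\<^sub>2\<in>carrier R. \<forall>x\<^sub>3\<in>carrier R. \<forall>x\<^sub>4\<in>carrier R.
        x\<^sub>1 = x\<^sub>1 \<curlyvee>\<^bsub>R\<^esub> x\<^sub>2 \<or>
        x\<^sub>1 \<curlyvee>\<^bsub>R\<^esub> x\<^sub>2 = x\<^sub>1 \<curlyvee>\<^bsub>R\<^esub> x\<^sub>2 \<curlyvee>\<^bsub>R\<^esub> x\<^sub>3 \<or>
        x\<^sub>1 \<curlyvee>\<^bsub>R\<^esub> x\<^sub>2 \<curlyvee>\<^bsub>R\<^esub> x\<^sub>3 = x\<^sub>1 \<curlyvee>\<^bsub>R\<^esub> x\<^sub>2 \<curlyvee>\<^bsub>R\<^esub> x\<^sub>3 \<curlyvee>\<^bsub>R\<^esub> x\<^sub>4)"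

definition URL3 :: "'a res_lattice set" where
  "URL3 = {R. residuated_lattice R \<and> unilinear R \<and> height_le_3 R}"

definition bURL3 :: "'a bdd_res_lattice set" where
  "bURL3 = {R. bounded_residuated_lattice R \<and> unilinear R \<and> height_le_3 R}"

end

theory Submission
  imports Defs
begin

text \<open>
  Both directions go through an order-theoretic description of \<open>M_X\<close> that mentions no set
  \<open>X\<close>: there are a least element \<open>b\<close> and a greatest element \<open>t \<noteq> b\<close>, and every comparable pair
  of distinct elements contains one of them, as \<open>b\<close> below or \<open>t\<close> above (\<open>M_shaped\<close>). A lattice
  isomorphism onto \<open>M_X\<close> is the same as an order isomorphism, hence it transports this property back
  from \<open>M_X\<close>; conversely a lattice of this shape is isomorphic to \<open>M_X\<close> for \<open>X\<close> the set of its
  elements other than \<open>b\<close> and \<open>t\<close>.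

  The two first-order conditions have an equally plain order-theoretic meaning. Unilinearity says that
  incomparable elements meet in the least element and join to the greatest one, and the second
  condition excludes chains of four elements, because the partial joins
  \<open>x\<^sub>1 \<le> x\<^sub>1 \<curlyvee> x\<^sub>2 \<le> \<dots>\<close> run through all four-term chains. In an \<open>M_shaped\<close> lattice both are evident.
  Conversely, the absence of four-element chains yields the shape as soon as there are bounds \<open>b \<noteq> t\<close>, since
  \<open>b < x < y < t\<close> is forbidden. An incomparable pair provides the bounds by unilinearity. Without such
  a pair the lattice is a chain, and a chain with no least or no greatest element
  has arbitrarily long strictly monotone sequences. Only the one-element lattice escapes, by having \<open>b = t\<close>.

  The argument takes place in the lattice reduct, the unit only supplying an element to start a
  sequence from, and therefore serves residuated lattices and
  their bounded expansions alike.
\<close>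

section \<open>The shape of \<open>M_X\<close>\<close>

definition M_shaped :: "('a, 'c) gorder_scheme \<Rightarrow> 'a \<Rightarrow> 'a \<Rightarrow> bool" where
  "M_shaped L b t \<longleftrightarrow> b \<in> carrier L \<and> t \<in> carrier L \<and> b \<noteq> t \<and>
     (\<forall>x\<in>carrier L. b \<sqsubseteq>\<^bsub>L\<^esub> x \<and> x \<sqsubseteq>\<^bsub>L\<^esub> t) \<and>
     (\<forall>x\<in>carrier L. \<forall>y\<in>carrier L. x \<sqsubseteq>\<^bsub>L\<^esub> y \<longrightarrow> x = y \<or> x = b \<or> y = t)"

text \<open>
  The order is recovered from joins by \<open>x \<le> y \<longleftrightarrow> x \<squnion> y = y\<close>, and joins and meets are determined by
  the order.
\<close>

lemma lattice_isomorphic_iff_order_isomorphic: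
  assumes "lattice L" "lattice K"
  shows "lattice_isomorphic L K \<longleftrightarrow>
    (\<exists>h. bij_betw h (carrier L) (carrier K) \<and>
         (\<forall>x\<in>carrier L. \<forall>y\<in>carrier L. h x \<sqsubseteq>\<^bsub>K\<^esub> h y \<longleftrightarrow> x \<sqsubseteq>\<^bsub>L\<^esub> y))"
    (is "_ \<longleftrightarrow> (\<exists>h. ?bij h \<and> ?iso h)")
proof -
  interpret L: lattice L by fact
  interpret K: lattice K by fact
  have order: "?iso h" if bij: "?bij h" and join: "join_pres L K h" for h
  proof (intro ballI)
    fix x y assume xy: "x \<in> carrier L" "y \<in> carrier L"
    then have h: "h x \<in> carrier K" "h y \<in> carrier K"
      using bij by (auto dest: bij_betwE)
    have "h x \<sqsubseteq>\<^bsub>K\<^esub> h y \<longleftrightarrow> h (x \<squnion>\<^bsub>L\<^esub> y) = h y"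
      using join xy K.le_iff_meet[OF h] by (simp add: join_pres_def)
    also have "\<dots> \<longleftrightarrow> x \<squnion>\<^bsub>L\<^esub> y = y"
      using bij xy by (auto simp: bij_betw_def inj_on_eq_iff)
    also have "\<dots> \<longleftrightarrow> x \<sqsubseteq>\<^bsub>L\<^esub> y"
      using L.le_iff_meet[OF xy] by simp
    finally show "h x \<sqsubseteq>\<^bsub>K\<^esub> h y \<longleftrightarrow> x \<sqsubseteq>\<^bsub>L\<^esub> y" .
  qed
  have operations: "join_pres L K h \<and> meet_pres L K h" if bij: "?bij h" and iso: "?iso h" for h
  proof -
    have h: "h x \<in> carrier K" if "x \<in> carrier L" for x
      using bij that by (auto dest: bij_betwE)
    have "h (x \<squnion>\<^bsub>L\<^esub> y) = h x \<squnion>\<^bsub>K\<^esub> h y" if xy: "x \<in> carrier L" "y \<in> carrier L" for x y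
    proof -
      obtain z where z: "z \<in> carrier L" "h z = h x \<squnion>\<^bsub>K\<^esub> h y"
        using bij_betw_imp_surj_on[OF bij] K.join_closed[OF h h, OF xy] by (metis imageE)
      have "x \<sqsubseteq>\<^bsub>L\<^esub> z" "y \<sqsubseteq>\<^bsub>L\<^esub> z"
        using z iso xy K.join_left[OF h h] K.join_right[OF h h] by metis+
      then have "h (x \<squnion>\<^bsub>L\<^esub> y) \<sqsubseteq>\<^bsub>K\<^esub> h z"
        using iso[rule_format, OF L.join_closed[OF xy] z(1)] L.join_le xy z(1) by blast
      moreover have "h x \<squnion>\<^bsub>K\<^esub> h y \<sqsubseteq>\<^bsub>K\<^esub> h (x \<squnion>\<^bsub>L\<^esub> y)"
        using iso xy h by (simp add: K.join_le L.join_left L.join_right)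
      ultimately show ?thesis
        using xy z(2) by (simp add: K.le_antisym h)
    qed
    moreover have "h (x \<sqinter>\<^bsub>L\<^esub> y) = h x \<sqinter>\<^bsub>K\<^esub> h y" if xy: "x \<in> carrier L" "y \<in> carrier L" for x y
    proof -
      obtain z where z: "z \<in> carrier L" "h z = h x \<sqinter>\<^bsub>K\<^esub> h y"
        using bij_betw_imp_surj_on[OF bij] K.meet_closed[OF h h, OF xy] by (metis imageE)
      have "z \<sqsubseteq>\<^bsub>L\<^esub> x" "z \<sqsubseteq>\<^bsub>L\<^esub> y"
        using z iso xy K.meet_left[OF h h] K.meet_right[OF h h] by metis+
      then have "h z \<sqsubseteq>\<^bsub>K\<^esub> h (x \<sqinter>\<^bsub>L\<^esub> y)"
        using iso[rule_format, OF z(1) L.meet_closed[OF xy]] L.meet_le xy z(1) by blast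
      moreover have "h (x \<sqinter>\<^bsub>L\<^esub> y) \<sqsubseteq>\<^bsub>K\<^esub> h x \<sqinter>\<^bsub>K\<^esub> h y"
        using iso xy h by (simp add: K.meet_le L.meet_left L.meet_right)
      ultimately show ?thesis
        using xy z(2) by (simp add: K.le_antisym h)
    qed
    ultimately show ?thesis
      using assms by (simp add: join_pres_def meet_pres_def)
  qed
  have "join_pres L K h \<and> meet_pres L K h \<longleftrightarrow> ?iso h" if "?bij h" for h
    by (rule iffI, rule order[OF that], erule conjunct1, rule operations[OF that])
  then show ?thesis
    unfolding lattice_isomorphic_def by (rule iff_exI[OF conj_cong[OF refl]])
qed

lemma M_shaped_if_isomorphic:
  assumes "lattice L" "lattice_isomorphic L (M_lattice X)"
  shows "\<exists>b t. M_shaped L b t"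
proof -
  obtain h where bij: "bij_betw h (carrier L) (carrier (M_lattice X))"
    and iso: "\<forall>x\<in>carrier L. \<forall>y\<in>carrier L. h x \<sqsubseteq>\<^bsub>M_lattice X\<^esub> h y \<longleftrightarrow> x \<sqsubseteq>\<^bsub>L\<^esub> y"
    using assms lattice_isomorphic_iff_order_isomorphic lattice_M_lattice by blast
  have "M_bot \<in> carrier (M_lattice X)" "M_top \<in> carrier (M_lattice X)"
    by (simp_all add: M_lattice_def)
  then obtain b t where bt: "b \<in> carrier L" "h b = M_bot" "t \<in> carrier L" "h t = M_top"
    unfolding bij_betw_imp_surj_on[OF bij, symmetric] by force
  have inj: "h x = h y \<longleftrightarrow> x = y" if "x \<in> carrier L" "y \<in> carrier L" for x y
    using bij that by (auto simp: bij_betw_def inj_on_eq_iff)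
  have le: "x \<sqsubseteq>\<^bsub>L\<^esub> y \<longleftrightarrow> x = y \<or> x = b \<or> y = t" if "x \<in> carrier L" "y \<in> carrier L" for x y
  proof -
    have "x \<sqsubseteq>\<^bsub>L\<^esub> y \<longleftrightarrow> h x = h y \<or> h x = h b \<or> h y = h t"
      using iso that bt by (simp add: M_lattice_def)
    then show ?thesis
      using inj[OF that] inj[OF that(1) bt(1)] inj[OF that(2) bt(3)] by blast
  qed
  have "M_shaped L b t"
    unfolding M_shaped_def using bt le by auto
  then show ?thesis by blast
qed

lemma isomorphic_if_M_shaped:
  assumes L: "lattice L" and shape: "M_shaped L b t"
  shows "lattice_isomorphic L (M_lattice (carrier L - {b, t}))"
proof -
  interpret lattice L by fact
  let ?h = "\<lambda>x. if x = b then M_bot else if x = t then M_top else M_atom x"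
  have bt: "b \<in> carrier L" "t \<in> carrier L" "b \<noteq> t"
    using shape by (auto simp: M_shaped_def)
  have le: "x \<sqsubseteq>\<^bsub>L\<^esub> y \<longleftrightarrow> x = y \<or> x = b \<or> y = t" if "x \<in> carrier L" "y \<in> carrier L" for x y
    using shape that by (auto simp: M_shaped_def)
  have "?h ` carrier L = carrier (M_lattice (carrier L - {b, t}))"
    using bt by (auto simp: M_lattice_def image_iff)
  moreover have "inj_on ?h (carrier L)"
    by (auto simp: inj_on_def split: if_splits)
  ultimately have "bij_betw ?h (carrier L) (carrier (M_lattice (carrier L - {b, t})))"
    by (simp add: bij_betw_def)
  moreover have "\<forall>x\<in>carrier L. \<forall>y\<in>carrier L.
      ?h x \<sqsubseteq>\<^bsub>M_lattice (carrier L - {b, t})\<^esub> ?h y \<longleftrightarrow> x \<sqsubseteq>\<^bsub>L\<^esub> y"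
    using bt by (auto simp: le M_lattice_def)
  ultimately show ?thesis
    unfolding lattice_isomorphic_iff_order_isomorphic[OF L lattice_M_lattice] by blast
qed

section \<open>Unilinearity and chains of four elements\<close>

text \<open>
  Exceeding height three means carrying a strictly increasing chain of four elements: a failure
  of \<open>height_le_3\<close> is witnessed by partial joins, and along a chain each partial join is its
  last term.
\<close>

lemma (in residuated_lattice) height_le_3_iff_no_chain:
  "height_le_3 R \<longleftrightarrow>
     \<not> (\<exists>x\<^sub>1\<in>carrier R. \<exists>x\<^sub>2\<in>carrier R. \<exists>x\<^sub>3\<in>carrier R. \<exists>x\<^sub>4\<in>carrier R.
          x\<^sub>1 \<preceq> x\<^sub>2 \<and> x\<^sub>1 \<noteq> x\<^sub>2 \<and> x\<^sub>2 \<preceq> x\<^sub>3 \<and> x\<^sub>2 \<noteq> x\<^sub>3 \<and> x\<^sub>3 \<preceq> x\<^sub>4 \<and> x\<^sub>3 \<noteq> x\<^sub>4)"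
    (is "_ \<longleftrightarrow> \<not> ?chain")
proof -
  interpret L: lattice "lattice_reduct R" by (rule lattice_reduct)
  have carr: "carrier (lattice_reduct R) = carrier R"
    by (simp add: lattice_reduct_def)
  have closed: "x \<curlyvee> y \<in> carrier R" if "x \<in> carrier R" "y \<in> carrier R" for x y
    using that L.join_closed vee_is_join carr by simp
  have upper: "x \<preceq> x \<curlyvee> y" if "x \<in> carrier R" "y \<in> carrier R" for x y
    using that L.join_left vee_is_join carr by simp
  have absorb: "x \<curlyvee> y = y" if "x \<in> carrier R" "y \<in> carrier R" "x \<preceq> y" for x y
    using that L.le_iff_meet vee_is_join carr by simp
  show ?thesis
  proof
    assume height: "height_le_3 R"
    show "\<not> ?chain"
    proof
      assume ?chain
      then obtain x1 x2 x3 x4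
        where x: "x1 \<in> carrier R" "x2 \<in> carrier R" "x3 \<in> carrier R" "x4 \<in> carrier R"
        and le: "x1 \<preceq> x2" "x2 \<preceq> x3" "x3 \<preceq> x4" and ne: "x1 \<noteq> x2" "x2 \<noteq> x3" "x3 \<noteq> x4"
        by blast
      have "x1 = x1 \<curlyvee> x2 \<or> x1 \<curlyvee> x2 = x1 \<curlyvee> x2 \<curlyvee> x3
          \<or> x1 \<curlyvee> x2 \<curlyvee> x3 = x1 \<curlyvee> x2 \<curlyvee> x3 \<curlyvee> x4"
        using height x unfolding height_le_3_def by blast
      then show False
        using x le ne by (simp add: absorb)
    qed
  next
    assume no_chain: "\<not> ?chain"
    show "height_le_3 R"
      unfolding height_le_3_def
    proof (intro ballI)
      fix x1 x2 x3 x4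
      assume x: "x1 \<in> carrier R" "x2 \<in> carrier R" "x3 \<in> carrier R" "x4 \<in> carrier R"
      let ?y2 = "x1 \<curlyvee> x2" and ?y3 = "x1 \<curlyvee> x2 \<curlyvee> x3" and ?y4 = "x1 \<curlyvee> x2 \<curlyvee> x3 \<curlyvee> x4"
      have y: "?y2 \<in> carrier R" "?y3 \<in> carrier R" "?y4 \<in> carrier R"
        using x by (simp_all add: closed)
      have "x1 \<preceq> ?y2" "?y2 \<preceq> ?y3" "?y3 \<preceq> ?y4"
        using x y by (simp_all only: upper)
      then show "x1 = ?y2 \<or> ?y2 = ?y3 \<or> ?y3 = ?y4"
        using no_chain x(1) y by blast
    qed
  qed
qed

text \<open>
  Once there are bounds \<open>b\<close> and \<open>t\<close>, elements \<open>x < y\<close> with \<open>x \<noteq> b\<close> and \<open>y \<noteq> t\<close> would give the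
  forbidden chain \<open>b < x < y < t\<close>. The bounds come from an incomparable pair by unilinearity, and in a
  chain from the height condition.
\<close>

lemma (in residuated_lattice) M_shaped_or_trivial:
  assumes uni: "unilinear R" and height: "height_le_3 R" and nontrivial: "\<not> trivial_algebra R"
  shows "\<exists>b t. M_shaped (lattice_reduct R) b t"
proof -
  interpret L: lattice "lattice_reduct R" by (rule lattice_reduct)
  have carr: "carrier (lattice_reduct R) = carrier R"
    by (simp add: lattice_reduct_def)
  have no_chain: False
    if "x1 \<in> carrier R" "x2 \<in> carrier R" "x3 \<in> carrier R" "x4 \<in> carrier R"
      "x1 \<preceq> x2" "x1 \<noteq> x2" "x2 \<preceq> x3" "x2 \<noteq> x3" "x3 \<preceq> x4" "x3 \<noteq> x4" for x1 x2 x3 x4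
    using height that unfolding height_le_3_iff_no_chain by blast
  have "\<exists>b\<in>carrier R. \<exists>t\<in>carrier R. \<forall>x\<in>carrier R. b \<preceq> x \<and> x \<preceq> t"
  proof (cases "\<forall>u\<in>carrier R. \<forall>v\<in>carrier R. u \<preceq> v \<or> v \<preceq> u")
    case True
    then have total: "u \<preceq> v \<or> v \<preceq> u" if "u \<in> carrier R" "v \<in> carrier R" for u v
      using that by blast
    \<comment> \<open>Stepping strictly down, or strictly up, three times from \<open>\<one>\<close> gives a forbidden chain.\<close>
    have "\<exists>b\<in>carrier R. \<forall>x\<in>carrier R. b \<preceq> x"
    proof (rule ccontr)
      assume "\<not> ?thesis"
      then have down: "\<exists>y\<in>carrier R. y \<preceq> x \<and> y \<noteq> x" if "x \<in> carrier R" for x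
        using that total by metis
      obtain x3 where x3: "x3 \<in> carrier R" "x3 \<preceq> \<one>" "x3 \<noteq> \<one>"
        using down by blast
      obtain x2 where x2: "x2 \<in> carrier R" "x2 \<preceq> x3" "x2 \<noteq> x3"
        using down x3 by blast
      obtain x1 where "x1 \<in> carrier R" "x1 \<preceq> x2" "x1 \<noteq> x2"
        using down x2 by blast
      with x2 x3 show False
        using no_chain[of x1 x2 x3 \<one>] by simp
    qed
    moreover have "\<exists>t\<in>carrier R. \<forall>x\<in>carrier R. x \<preceq> t"
    proof (rule ccontr)
      assume "\<not> ?thesis"
      then have up: "\<exists>y\<in>carrier R. x \<preceq> y \<and> x \<noteq> y" if "x \<in> carrier R" for x
        using that total by metis
      obtain x2 where x2: "x2 \<in> carrier R" "\<one> \<preceq> x2" "\<one> \<noteq> x2"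
        using up by blast
      obtain x3 where x3: "x3 \<in> carrier R" "x2 \<preceq> x3" "x2 \<noteq> x3"
        using up x2 by blast
      obtain x4 where "x4 \<in> carrier R" "x3 \<preceq> x4" "x3 \<noteq> x4"
        using up x3 by blast
      with x2 x3 show False
        using no_chain[of \<one> x2 x3 x4] by simp
    qed
    ultimately show ?thesis by blast
  next
    case False
    then obtain u v where uv: "u \<in> carrier R" "v \<in> carrier R" "\<not> u \<preceq> v" "\<not> v \<preceq> u"
      by blast
    then have "u \<curlywedge> v \<in> carrier R" "u \<curlyvee> v \<in> carrier R"
      using L.meet_closed L.join_closed wedge_is_meet vee_is_join carr by simp_all
    moreover have "u \<curlywedge> v \<preceq> x \<and> x \<preceq> u \<curlyvee> v" if "x \<in> carrier R" for x
      using uni uv that unfolding unilinear_def by blast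
    ultimately show ?thesis by blast
  qed
  then obtain b t where b: "b \<in> carrier R" "\<And>x. x \<in> carrier R \<Longrightarrow> b \<preceq> x"
    and t: "t \<in> carrier R" "\<And>x. x \<in> carrier R \<Longrightarrow> x \<preceq> t"
    by blast
  have "b \<noteq> t"
  proof
    assume "b = t"
    then have "x = b" if "x \<in> carrier R" for x
      using L.le_antisym[of x b] b t that carr by simp
    then have "carrier R = {b}"
      using b(1) by blast
    with nontrivial show False
      by (auto simp: trivial_algebra_def)
  qed
  moreover have "x = y \<or> x = b \<or> y = t" if "x \<in> carrier R" "y \<in> carrier R" "x \<preceq> y" for x y
    using no_chain[OF b(1) that(1,2) t(1) b(2)[OF that(1)] _ that(3) _ t(2)[OF that(2)]] by blast
  ultimately have "M_shaped (lattice_reduct R) b t"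
    by (simp add: M_shaped_def carr b t)
  then show ?thesis by blast
qed

lemma (in residuated_lattice) unilinear_if_M_shaped:
  assumes shape: "M_shaped (lattice_reduct R) b t"
  shows "unilinear R"
  unfolding unilinear_def
proof (intro ballI)
  interpret L: lattice "lattice_reduct R" by (rule lattice_reduct)
  have carr: "carrier (lattice_reduct R) = carrier R"
    by (simp add: lattice_reduct_def)
  have bounds: "b \<preceq> x" "x \<preceq> t" if "x \<in> carrier R" for x
    using shape that carr by (auto simp: M_shaped_def)
  have shape': "x = y \<or> x = b \<or> y = t" if "x \<in> carrier R" "y \<in> carrier R" "x \<preceq> y" for x y
    using shape that carr by (auto simp: M_shaped_def)
  fix u v z w
  assume uv: "u \<in> carrier R" "v \<in> carrier R" and zw: "z \<in> carrier R" "w \<in> carrier R"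
  have meet: "u \<curlywedge> v \<in> carrier R" "u \<curlywedge> v \<preceq> u" "u \<curlywedge> v \<preceq> v"
    using uv L.meet_closed L.meet_left L.meet_right wedge_is_meet carr by simp_all
  have join: "u \<curlyvee> v \<in> carrier R" "u \<preceq> u \<curlyvee> v" "v \<preceq> u \<curlyvee> v"
    using uv L.join_closed L.join_left L.join_right vee_is_join carr by simp_all
  \<comment> \<open>For incomparable \<open>u\<close>, \<open>v\<close> the comparison of \<open>u \<curlywedge> v\<close> with \<open>u\<close> is strict and \<open>u\<close> is not the top,
    so the meet is the bottom; dually for the join.\<close>
  have "u \<curlywedge> v = b \<and> u \<curlyvee> v = t" if inc: "\<not> u \<preceq> v" "\<not> v \<preceq> u"
  proof -
    have ne: "u \<noteq> b" "u \<noteq> t"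
      using inc uv bounds by blast+
    have "u \<curlywedge> v \<noteq> u" "u \<noteq> u \<curlyvee> v"
      using inc meet(3) join(3) by metis+
    then show ?thesis
      using shape'[OF meet(1) uv(1) meet(2)] shape'[OF uv(1) join(1) join(2)] ne by blast
  qed
  then show "u \<preceq> v \<or> v \<preceq> u \<or> u \<curlywedge> v \<preceq> w \<and> z \<preceq> u \<curlyvee> v"
    using bounds zw by auto
qed

lemma (in residuated_lattice) height_le_3_if_M_shaped:
  assumes shape: "M_shaped (lattice_reduct R) b t"
  shows "height_le_3 R"
proof -
  interpret L: lattice "lattice_reduct R" by (rule lattice_reduct)
  have carr: "carrier (lattice_reduct R) = carrier R"
    by (simp add: lattice_reduct_def)
  have bounds: "b \<in> carrier R" "t \<in> carrier R" "\<And>x. x \<in> carrier R \<Longrightarrow> b \<preceq> x \<and> x \<preceq> t"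
    using shape carr by (auto simp: M_shaped_def)
  have shape': "x = y \<or> x = b \<or> y = t" if "x \<in> carrier R" "y \<in> carrier R" "x \<preceq> y" for x y
    using shape that carr by (auto simp: M_shaped_def)
  \<comment> \<open>The middle step of \<open>x\<^sub>1 < x\<^sub>2 < x\<^sub>3 < x\<^sub>4\<close> neither starts at \<open>b\<close>, being above \<open>x\<^sub>1\<close>, nor ends
    at \<open>t\<close>, being below \<open>x\<^sub>4\<close>.\<close>
  have False
    if x: "x1 \<in> carrier R" "x2 \<in> carrier R" "x3 \<in> carrier R" "x4 \<in> carrier R"
    and le: "x1 \<preceq> x2" "x2 \<preceq> x3" "x3 \<preceq> x4" and ne: "x1 \<noteq> x2" "x2 \<noteq> x3" "x3 \<noteq> x4"
    for x1 x2 x3 x4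
  proof -
    have "x2 \<noteq> b"
      using L.le_antisym[of x1 b] bounds x le ne carr by auto
    moreover have "x3 \<noteq> t"
      using L.le_antisym[of t x4] bounds x le ne carr by auto
    ultimately show False
      using shape'[of x2 x3] x le ne by blast
  qed
  then show ?thesis
    unfolding height_le_3_iff_no_chain by blast
qed

text \<open>
  Here \<open>X\<close> is given, so its elements may have any type; in the converse \<open>X\<close> is built from elements of
  the algebra and has their type.
\<close>

lemma (in residuated_lattice) unilinear_height_le_3_if_based_on_M:
  assumes "based_on_M R (X :: 'x set)"
  shows "unilinear R \<and> height_le_3 R"
proof -
  obtain b t where "M_shaped (lattice_reduct R) b t"
    using assms M_shaped_if_isomorphic[OF lattice_reduct] unfolding based_on_M_def by blast
  then show ?thesis
    using unilinear_if_M_shaped height_le_3_if_M_shaped by blast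
qed

text \<open>
  A one-element algebra is not of the form \<open>M_X\<close>, but satisfies both conditions for want of two
  distinct elements.
\<close>

lemma (in residuated_lattice) based_on_M_or_trivial_iff:
  "(\<exists>X :: 'a set. based_on_M R X) \<or> trivial_algebra R \<longleftrightarrow> unilinear R \<and> height_le_3 R"
proof
  have "unilinear R \<and> height_le_3 R" if triv: "trivial_algebra R"
  proof -
    interpret L: lattice "lattice_reduct R" by (rule lattice_reduct)
    obtain a where a: "carrier R = {a}"
      using triv by (auto simp: trivial_algebra_def)
    then have "a \<preceq> a"
      using L.le_refl by (simp add: lattice_reduct_def)
    then have "unilinear R"
      using a by (simp add: unilinear_def)
    moreover have "height_le_3 R"
      unfolding height_le_3_iff_no_chain using a by simp
    ultimately show ?thesis by blast
  qed
  then show "unilinear R \<and> height_le_3 R"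
    if "(\<exists>X :: 'a set. based_on_M R X) \<or> trivial_algebra R"
    using that unilinear_height_le_3_if_based_on_M by blast
next
  show "(\<exists>X :: 'a set. based_on_M R X) \<or> trivial_algebra R"
    if "unilinear R \<and> height_le_3 R"
    using that M_shaped_or_trivial isomorphic_if_M_shaped[OF lattice_reduct]
    unfolding based_on_M_def by blast
qed

(* An algebra on a subset of 'a based on some M_X is also based on M_Y for some Y :: 'a set, so
   X ranges over sets of type 'a in the two equalities. The two inclusions let the elements of X
   have an arbitrary type 'x, unrelated to 'a. *)
theorem corollary3p2:
  shows "{R :: 'a res_lattice. residuated_lattice R \<and>
            ((\<exists>X :: 'a set. based_on_M R X) \<or> trivial_algebra R)} = URL3
    \<and> {R :: 'a bdd_res_lattice. bounded_residuated_lattice R \<and>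
            ((\<exists>X :: 'a set. based_on_M R X) \<or> trivial_algebra R)} = bURL3
    \<and> {R :: 'a res_lattice. residuated_lattice R \<and> (\<exists>X :: 'x set. based_on_M R X)} \<subseteq> URL3
    \<and> {R :: 'a bdd_res_lattice. bounded_residuated_lattice R \<and> (\<exists>X :: 'x set. based_on_M R X)}
        \<subseteq> bURL3"
proof (intro conjI)
  show "{R :: 'a res_lattice. residuated_lattice R \<and>
      ((\<exists>X :: 'a set. based_on_M R X) \<or> trivial_algebra R)} = URL3"
    unfolding URL3_def using residuated_lattice.based_on_M_or_trivial_iff by blast
  show "{R :: 'a bdd_res_lattice. bounded_residuated_lattice R \<and>
      ((\<exists>X :: 'a set. based_on_M R X) \<or> trivial_algebra R)} = bURL3"
    unfolding bURL3_def
    using residuated_lattice.based_on_M_or_trivial_iff bounded_residuated_lattice.axioms(1)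
    by blast
  show "{R :: 'a res_lattice. residuated_lattice R \<and> (\<exists>X :: 'x set. based_on_M R X)} \<subseteq> URL3"
    unfolding URL3_def using residuated_lattice.unilinear_height_le_3_if_based_on_M by blast
  show "{R :: 'a bdd_res_lattice. bounded_residuated_lattice R \<and>
      (\<exists>X :: 'x set. based_on_M R X)} \<subseteq> bURL3"
    unfolding bURL3_def
    using residuated_lattice.unilinear_height_le_3_if_based_on_M
      bounded_residuated_lattice.axioms(1)
    by blast
qed

end
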